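(* Let $T>0$ and let $a,\kappa$ satisfy the assumptions of the context. Let $g:\mathbb{R}\to\mathbb{R}$ be twice continuously differentiable with bounded derivatives. Let $f\in C^1(\mathbb{R})$ be periodic with period $1$ and let $U$ be uniformly distributed on $[0,1]$. For each $P\in\mathbb{N}$ let $\zeta^1,\dots,\zeta^P\in[0,1]$ be points forming a finite subgroup of $\mathbb{R}/\mathbb{Z}$ (of order $P$), and let $X_i^P$, $i=1,\dots,P$, be the solution of $$X_i^P(t)=f(\{\zeta^i+U\})+\int_0^t a\Big(X_i^P(s),\frac1P\sum_{j=1}^P\kappa(X_i^P(s),X_j^P(s))\Big)ds,\quad 1\le i\le P,\ t\in[0,T].$$ Then there is a constant $K$ not depending on $P$ such that for all $P$ $$\operatorname{Var}\left[\frac1P\sum_{i=1}^P g(X_i^P(T))\right]\le K\sup_{x\in[0,1]}\Delta_{\{\zeta+x\}}^2 .$$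
   Context: Assumptions: $a:\mathbb{R}\times\mathbb{R}\to\mathbb{R}$ is bounded with continuous and bounded partial derivatives up to second order; $\kappa:\mathbb{R}\times\mathbb{R}\to\mathbb{R}$ is bounded with continuous and bounded first-order partial derivatives. Notation: $\{x\}$ is the fractional part of $x$. For points $\eta^1,\dots,\eta^P\in[0,1]$ the star discrepancy is $\Delta_\eta=\sup_{y\in[0,1]}\big|\frac1P\sum_{i=1}^P1_{[0,y]}(\eta^i)-y\big|$, and $\Delta_{\{\zeta+x\}}$ is the star discrepancy of the shifted points $\{\zeta^1+x\},\dots,\{\zeta^P+x\}$. *)

theory Defs
  imports "HOL-Probability.Probability" "HOL-Algebra.Coset"
begin

definition partial1 :: "(real \<times> real \<Rightarrow> real) \<Rightarrow> real \<times> real \<Rightarrow> real" where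
  "partial1 h = (\<lambda>(x, y). deriv (\<lambda>t. h (t, y)) x)"

definition partial2 :: "(real \<times> real \<Rightarrow> real) \<Rightarrow> real \<times> real \<Rightarrow> real" where
  "partial2 h = (\<lambda>(x, y). deriv (\<lambda>t. h (x, t)) y)"

definition partially_differentiable :: "(real \<times> real \<Rightarrow> real) \<Rightarrow> bool" where
  "partially_differentiable h \<longleftrightarrow>
     (\<forall>x y. (\<lambda>t. h (t, y)) differentiable (at x) \<and> (\<lambda>t. h (x, t)) differentiable (at y))"

text \<open>
  \<open>bounded_C 2 h\<close> says that \<open>h\<close> is bounded and that all its partial derivatives up to
  second order (the four second-order ones included) exist on the whole plane and are continuous
  and bounded. Continuity of \<open>h\<close> and of its derivatives below the top order is not
  listed separately, as it follows from their having bounded partial derivatives.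
\<close>

fun bounded_C :: "nat \<Rightarrow> (real \<times> real \<Rightarrow> real) \<Rightarrow> bool" where
  "bounded_C 0 h \<longleftrightarrow> bounded (range h) \<and> continuous_on UNIV h"
| "bounded_C (Suc k) h \<longleftrightarrow>
     bounded (range h) \<and> partially_differentiable h \<and>
     bounded_C k (partial1 h) \<and> bounded_C k (partial2 h)"

text \<open>Here \<open>g\<close> itself may be unbounded; only its first two derivatives are bounded.\<close>

definition C2_bounded_derivatives :: "(real \<Rightarrow> real) \<Rightarrow> bool" where
  "C2_bounded_derivatives g \<longleftrightarrow>
     (\<exists>g' g''. (\<forall>x. (g has_real_derivative g' x) (at x)) \<and>
               (\<forall>x. (g' has_real_derivative g'' x) (at x)) \<and>
               continuous_on UNIV g'' \<and> bounded (range g') \<and> bounded (range g''))"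

definition star_discrepancy :: "nat \<Rightarrow> (nat \<Rightarrow> real) \<Rightarrow> real" where
  "star_discrepancy P \<eta> =
     (SUP y\<in>{0..1}. \<bar>(1 / real P) * (\<Sum>i=1..P. indicator {0..y} (\<eta> i)) - y\<bar>)"

definition real_group :: "real monoid" where
  "real_group = \<lparr>carrier = UNIV, monoid.mult = (+), one = 0\<rparr>"

definition circle_group :: "real set monoid" where
  "circle_group = real_group Mod \<int>"

text \<open>
  The cardinality condition expresses that the subgroup has order \<open>P\<close>, so that
  the \<open>P\<close> points are distinct modulo 1.
\<close>

definition forms_circle_subgroup :: "nat \<Rightarrow> (nat \<Rightarrow> real) \<Rightarrow> bool" where
  "forms_circle_subgroup P \<zeta> \<longleftrightarrow>
     (let H = (\<lambda>i. \<int> #>\<^bsub>real_group\<^esub> \<zeta> i) ` {1..P}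
      in subgroup H circle_group \<and> card H = P)"

text \<open>
  The argument \<open>x i t\<close> is the position of particle \<open>i\<close> at time \<open>t\<close>, and
  \<open>x0 i\<close> its initial value. Stating the equation with \<^const>\<open>has_integral\<close>
  includes integrability of the right-hand side, and hence continuity of \<open>x i\<close> on \<open>[0, T]\<close>.
\<close>

definition particle_solution ::
  "(real \<times> real \<Rightarrow> real) \<Rightarrow> (real \<times> real \<Rightarrow> real) \<Rightarrow> real \<Rightarrow> nat \<Rightarrow> (nat \<Rightarrow> real) \<Rightarrow>
     (nat \<Rightarrow> real \<Rightarrow> real) \<Rightarrow> bool" where
  "particle_solution a \<kappa> T P x0 x \<longleftrightarrow>
     (\<forall>i\<in>{1..P}. \<forall>t\<in>{0..T}.
        ((\<lambda>s. a (x i s, (1 / real P) * (\<Sum>j=1..P. \<kappa> (x i s, x j s))))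
           has_integral (x i t - x0 i)) {0..t})"

end

theory Submission
  imports Defs "HOL-Algebra.Multiplicative_Group"
begin

text \<open>
  A subgroup of order \<open>P\<close> of the circle consists of the multiples of \<open>1 / P\<close>, so two of its translates
  can be matched by a permutation that moves every point by at most \<open>1 / P\<close>. The particle system is
  invariant under relabelling and, by Gronwall's inequality, depends Lipschitz continuously on its
  initial values, with a constant independent of \<open>P\<close>. Hence the averaged observable oscillates by at
  most \<open>L / P\<close>, and its variance is at most \<open>(L / P)\<^sup>2\<close>. On the other hand \<open>P\<close> points never have star
  discrepancy below \<open>1 / (2 P)\<close>, as one sees by testing with \<open>y = 1 / (2 P)\<close>.
\<close>

section \<open>Lipschitz bounds\<close>

lemma lipschitz_on_UNIV_of_deriv_bound:
  fixes h :: "real \<Rightarrow> real"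
  assumes "\<And>x. (h has_real_derivative h' x) (at x)" and "\<And>x. \<bar>h' x\<bar> \<le> B"
  shows "\<bar>h x - h y\<bar> \<le> B * \<bar>x - y\<bar>"
  using field_differentiable_bound[of UNIV h h' B x y] assms by simp

text \<open>The mean value theorem is applied along one coordinate at a time, via the intermediate
  point \<open>(x', y)\<close>, so bounds on the partial derivatives are enough and total
  differentiability never enters. The index \<open>Suc k\<close> lets the lemma serve both
  \<open>a\<close> (order 2) and \<open>\<kappa>\<close> (order 1).\<close>

lemma bounded_C_Suc_lipschitz:
  assumes "bounded_C (Suc k) h"
  obtains B where "B \<ge> 0"
    and "\<And>x y x' y'. \<bar>h (x, y) - h (x', y')\<bar> \<le> B * (\<bar>x - x'\<bar> + \<bar>y - y'\<bar>)"
proof -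
  have pd: "partially_differentiable h" 
    and bd: "bounded (range (partial1 h))" "bounded (range (partial2 h))"
    using assms by (cases k; simp)+
  from bd obtain B1 B2 where B: "\<And>p. \<bar>partial1 h p\<bar> \<le> B1" "\<And>p. \<bar>partial2 h p\<bar> \<le> B2"
    unfolding bounded_iff by auto
  have d1: "((\<lambda>t. h (t, y)) has_real_derivative partial1 h (x, y)) (at x)" for x y
    using pd unfolding partially_differentiable_def partial1_def
    by (auto simp: DERIV_deriv_iff_real_differentiable)
  have d2: "((\<lambda>t. h (x, t)) has_real_derivative partial2 h (x, y)) (at y)" for x y
    using pd unfolding partially_differentiable_def partial2_def
    by (auto simp: DERIV_deriv_iff_real_differentiable)
  define B where "B = max B1 B2"
  have "\<bar>h (x, y) - h (x', y')\<bar> \<le> B * (\<bar>x - x'\<bar> + \<bar>y - y'\<bar>)" for x y x' y'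
  proof -
    have "\<bar>h (x, y) - h (x', y)\<bar> \<le> B * \<bar>x - x'\<bar>"
      by (rule lipschitz_on_UNIV_of_deriv_bound[OF d1]) (use B(1) in \<open>simp add: B_def le_max_iff_disj\<close>)
    moreover have "\<bar>h (x', y) - h (x', y')\<bar> \<le> B * \<bar>y - y'\<bar>"
      by (rule lipschitz_on_UNIV_of_deriv_bound[OF d2]) (use B(2) in \<open>simp add: B_def le_max_iff_disj\<close>)
    ultimately show ?thesis by (simp add: algebra_simps)
  qed
  moreover have "B \<ge> 0"
    using order.trans[OF abs_ge_zero B(1)] by (simp add: B_def le_max_iff_disj)
  ultimately show thesis using that by blast
qed

lemma C2_bounded_derivatives_lipschitz:
  assumes "C2_bounded_derivatives g"
  obtains B where "B \<ge> 0" and "\<And>x y. \<bar>g x - g y\<bar> \<le> B * \<bar>x - y\<bar>"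
proof -
  obtain g' where g': "\<And>x. (g has_real_derivative g' x) (at x)" "bounded (range g')"
    using assms unfolding C2_bounded_derivatives_def by auto
  then obtain B where B: "\<And>x. \<bar>g' x\<bar> \<le> B"
    unfolding bounded_iff by auto
  have "B \<ge> 0" using B[of 0] by simp
  with that lipschitz_on_UNIV_of_deriv_bound[OF g'(1) B] show thesis by blast
qed

lemma periodic_of_int:
  fixes f :: "real \<Rightarrow> 'a"
  assumes "\<And>x. f (x + 1) = f x"
  shows "f (x + of_int k) = f x"
proof (induction k rule: int_induct[where k = 0])
  case (step1 i)
  then show ?case using assms[of "x + of_int i"] by (simp add: algebra_simps)
next
  case (step2 i)
  then show ?case using assms[of "x + of_int (i - 1)"] by (simp add: algebra_simps)
qed simp

lemma periodic_Ints:
  fixes f :: "real \<Rightarrow> 'a"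
  assumes "\<And>x. f (x + 1) = f x" and "x - y \<in> \<int>"
  shows "f x = f y"
proof -
  from assms(2) obtain k where "x - y = of_int k" by (auto elim: Ints_cases)
  then have "x = y + of_int k" by simp
  then show ?thesis using periodic_of_int[of f y k] assms(1) by simp
qed

lemma frac_diff_Ints: "frac x - x \<in> \<int>" for x :: real
  by (simp add: frac_def)

text \<open>The derivative inherits the period. Being continuous, it is bounded on the compact
  interval \<open>{0..1}\<close>, and periodicity carries that bound to the whole line.\<close>

lemma periodic_C1_lipschitz:
  fixes f :: "real \<Rightarrow> real"
  assumes "f C1_differentiable_on UNIV" and per: "\<And>x. f (x + 1) = f x"
  obtains B where "B \<ge> 0" and "\<And>x y. \<bar>f x - f y\<bar> \<le> B * \<bar>x - y\<bar>"
proof -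
  obtain D where D: "\<And>x. (f has_real_derivative D x) (at x)" and cont: "continuous_on UNIV D"
    using assms(1) unfolding C1_differentiable_on_def
    by (auto simp: has_real_derivative_iff_has_vector_derivative)
  have Dper: "D (x + 1) = D x" for x
  proof (rule DERIV_unique)
    show "(f has_real_derivative D (x + 1)) (at x)"
      using D[of "x + 1"] unfolding DERIV_shift by (simp add: per)
  qed (rule D)
  have "compact (D ` {0..1})"
    by (intro compact_continuous_image continuous_on_subset[OF cont]) auto
  then have "bounded (D ` {0..1})" by (rule compact_imp_bounded)
  then obtain B where B: "\<And>x. x \<in> {0..1} \<Longrightarrow> \<bar>D x\<bar> \<le> B"
    unfolding bounded_iff by (metis imageI real_norm_def)
  have "\<bar>D x\<bar> \<le> B" for x
    using B[of "frac x"] periodic_Ints[of D, OF Dper frac_diff_Ints[of x]]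
    by (simp add: frac_ge_0 less_imp_le[OF frac_lt_1])
  moreover have "B \<ge> 0" using B[of 0] by simp
  ultimately show thesis
    using that lipschitz_on_UNIV_of_deriv_bound[OF D] by blast
qed

section \<open>Stability of the particle system\<close>

text \<open>The integrating factor \<open>exp (- C * t)\<close> turns the right-hand side of the
  hypothesis into the nonincreasing function \<open>\<phi>\<close>: its derivative contains the
  factor \<open>S t - (\<delta> + C * R t)\<close>, which the hypothesis makes nonpositive. No sign
  of \<open>S\<close> or \<open>\<delta>\<close> is involved.\<close>

lemma gronwall_integral:
  fixes S :: "real \<Rightarrow> real"
  assumes "T \<ge> 0" and "C \<ge> 0" and cont: "continuous_on {0..T} S"
    and le: "\<And>t. t \<in> {0..T} \<Longrightarrow> S t \<le> \<delta> + C * integral {0..t} S"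
  shows "S T \<le> \<delta> * exp (C * T)"
proof -
  define R where "R t = integral {0..t} S" for t
  define \<phi> where "\<phi> t = (\<delta> + C * R t) * exp (- C * t)" for t
  have "\<phi> T \<le> \<phi> 0"
  \<comment> \<open>At the end points \<open>R\<close> has only a derivative within
    \<open>{0..T}\<close>, hence the criterion that asks for a two-sided derivative inside the
    interval and for continuity on the closed one.\<close>
  proof (rule DERIV_nonpos_imp_decreasing_open[of 0 T \<phi>])
    have R: "(R has_real_derivative S t) (at t within {0..T})" if "t \<in> {0..T}" for t
      unfolding R_def by (rule integral_has_real_derivative[OF cont that])
    then have "continuous_on {0..T} R"
      by (rule DERIV_continuous_on)
    then show "continuous_on {0..T} \<phi>"
      unfolding \<phi>_def by (intro continuous_intros)
    show "\<exists>y. (\<phi> has_real_derivative y) (at t) \<and> y \<le> 0" if "0 < t" "t < T" for t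
    proof (intro exI conjI)
      have [derivative_intros]: "(R has_real_derivative S t) (at t)"
        using R[of t] that at_within_Icc_at[of 0 t T] by simp
      show "(\<phi> has_real_derivative C * exp (- C * t) * (S t - (\<delta> + C * R t))) (at t)"
        unfolding \<phi>_def by (auto intro!: derivative_eq_intros simp: algebra_simps)
      show "C * exp (- C * t) * (S t - (\<delta> + C * R t)) \<le> 0"
        using le[of t] that \<open>C \<ge> 0\<close> by (intro mult_nonneg_nonpos) (auto simp: R_def)
    qed
  qed (fact \<open>T \<ge> 0\<close>)
  also have "\<phi> 0 = \<delta>" by (simp add: \<phi>_def R_def)
  finally have "(\<delta> + C * R T) * exp (- C * T) \<le> \<delta>" by (simp add: \<phi>_def)
  then have "\<delta> + C * R T \<le> \<delta> * exp (C * T)"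
    by (simp add: exp_minus field_simps)
  then show ?thesis using le[of T] \<open>T \<ge> 0\<close> by (simp add: R_def)
qed

text \<open>The interaction is a mean over all particles and hence symmetric in them. The relabelled
  family is thus itself a solution, so particle \<open>i\<close> of one system can be compared with
  particle \<open>\<sigma> i\<close> of another.\<close>

lemma particle_solution_reindex:
  assumes "particle_solution a \<kappa> T P x0 x" and \<sigma>: "bij_betw \<sigma> {1..P} {1..P}"
  shows "particle_solution a \<kappa> T P (x0 \<circ> \<sigma>) (x \<circ> \<sigma>)"
proof -
  have "(\<Sum>j=1..P. \<kappa> (y, x (\<sigma> j) s)) = (\<Sum>j=1..P. \<kappa> (y, x j s))" for y s
    using sum.reindex_bij_betw[OF \<sigma>, of "\<lambda>j. \<kappa> (y, x j s)"] .
  moreover have "\<sigma> i \<in> {1..P}" if "i \<in> {1..P}" for i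
    using \<sigma> that by (auto simp: bij_betw_def)
  ultimately show ?thesis
    using assms(1) unfolding particle_solution_def by simp
qed

lemma particle_solution_continuous:
  assumes sol: "particle_solution a \<kappa> T P x0 x" and "T \<ge> 0" and i: "i \<in> {1..P}"
  shows "continuous_on {0..T} (x i)"
proof -
  let ?b = "\<lambda>s. a (x i s, (1 / real P) * (\<Sum>j=1..P. \<kappa> (x i s, x j s)))"
  have I: "(?b has_integral (x i t - x0 i)) {0..t}" if "t \<in> {0..T}" for t
    using sol i that unfolding particle_solution_def by blast
  have "?b integrable_on {0..T}"
    using I[of T] \<open>T \<ge> 0\<close> by (auto simp: integrable_on_def)
  then have "continuous_on {0..T} (\<lambda>t. x0 i + integral {0..t} ?b)"
    by (intro continuous_intros indefinite_integral_continuous_1)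
  then show ?thesis
    by (rule continuous_on_eq) (use integral_unique[OF I] in simp)
qed

text \<open>Averaging the distances over the particles before applying Gronwall replaces
  \<open>P\<close> coupled inequalities by a single one for \<open>S\<close>. This keeps the rate
  \<open>A + 2 * A * B\<close> free of \<open>P\<close>.\<close>

lemma particle_solution_stability:
  fixes P :: nat
  assumes "T \<ge> 0" and "A \<ge> 0" and "B \<ge> 0" and "P \<ge> 1"
    and a: "\<And>x y x' y'. \<bar>a (x, y) - a (x', y')\<bar> \<le> A * (\<bar>x - x'\<bar> + \<bar>y - y'\<bar>)"
    and \<kappa>: "\<And>x y x' y'. \<bar>\<kappa> (x, y) - \<kappa> (x', y')\<bar> \<le> B * (\<bar>x - x'\<bar> + \<bar>y - y'\<bar>)"
    and sol: "particle_solution a \<kappa> T P x0 x" and sol': "particle_solution a \<kappa> T P x0' x'"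
    and x0: "\<And>i. i \<in> {1..P} \<Longrightarrow> \<bar>x0 i - x0' i\<bar> \<le> \<delta>"
  shows "(1 / real P) * (\<Sum>i=1..P. \<bar>x i T - x' i T\<bar>) \<le> \<delta> * exp ((A + 2 * A * B) * T)"
proof -
  define b where "b i s = a (x i s, (1 / real P) * (\<Sum>j=1..P. \<kappa> (x i s, x j s)))" for i s
  define b' where "b' i s = a (x' i s, (1 / real P) * (\<Sum>j=1..P. \<kappa> (x' i s, x' j s)))" for i s
  define d where "d i s = \<bar>x i s - x' i s\<bar>" for i s
  define S where "S s = (1 / real P) * (\<Sum>i=1..P. d i s)" for s
  \<comment> \<open>Bound for the difference of the drifts: the particle's own position contributes
    \<open>A * d i s\<close>, and the mean of \<open>\<kappa>\<close> contributes
    \<open>A * (B * (d i s + S s))\<close>. Averaged over \<open>i\<close>, where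
    \<open>d i s\<close> becomes \<open>S s\<close>, this gives the rate
    \<open>A + 2 * A * B\<close>.\<close>
  define h where "h i s = A * (1 + B) * d i s + A * B * S s" for i s
  have P: "real P > 0" using \<open>P \<ge> 1\<close> by simp
  have bI: "(b i has_integral (x i t - x0 i)) {0..t}" "(b' i has_integral (x' i t - x0' i)) {0..t}"
    if "i \<in> {1..P}" "t \<in> {0..T}" for i t
    using sol sol' that unfolding particle_solution_def b_def b'_def by blast+
  have dcont: "continuous_on {0..T} (d i)" if "i \<in> {1..P}" for i
    unfolding d_def using that
    by (intro continuous_intros particle_solution_continuous[OF sol \<open>T \<ge> 0\<close>]
        particle_solution_continuous[OF sol' \<open>T \<ge> 0\<close>])
  have Scont: "continuous_on {0..T} S"
    unfolding S_def by (intro continuous_intros dcont)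
  have hcont: "continuous_on {0..T} (h i)" if "i \<in> {1..P}" for i
    unfolding h_def by (intro continuous_intros dcont that Scont)
  have b_diff: "\<bar>b i s - b' i s\<bar> \<le> h i s" for i s
  proof -
    let ?m = "(1 / real P) * (\<Sum>j=1..P. \<kappa> (x i s, x j s))"
    let ?m' = "(1 / real P) * (\<Sum>j=1..P. \<kappa> (x' i s, x' j s))"
    have "\<bar>?m - ?m'\<bar> = (1 / real P) * \<bar>\<Sum>j=1..P. (\<kappa> (x i s, x j s) - \<kappa> (x' i s, x' j s))\<bar>"
      by (simp add: sum_subtractf flip: diff_divide_distrib)
    also have "\<dots> \<le> (1 / real P) * (\<Sum>j=1..P. B * (d i s + d j s))"
      unfolding d_def by (intro mult_left_mono order.trans[OF sum_abs] sum_mono \<kappa>) simp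
    also have "\<dots> = B * (d i s + S s)"
      using P by (simp add: S_def sum.distrib field_simps flip: sum_distrib_left)
    finally have "\<bar>?m - ?m'\<bar> \<le> B * (d i s + S s)" .
    then have "A * (d i s + \<bar>?m - ?m'\<bar>) \<le> A * (d i s + B * (d i s + S s))"
      using \<open>A \<ge> 0\<close> by (intro mult_left_mono) auto
    also have "\<dots> = h i s" by (simp add: h_def algebra_simps)
    finally show ?thesis
      using a[of "x i s" ?m "x' i s" ?m'] unfolding b_def b'_def d_def by linarith
  qed
  have sum_h: "(\<Sum>i=1..P. h i s) = (A + 2 * A * B) * real P * S s" for s
  proof -
    have "(\<Sum>i=1..P. h i s) = A * (1 + B) * (\<Sum>i=1..P. d i s) + real P * (A * B * S s)"
      by (simp add: h_def sum.distrib flip: sum_distrib_left)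
    also have "(\<Sum>i=1..P. d i s) = real P * S s"
      using P by (simp add: S_def)
    finally show ?thesis by (simp add: algebra_simps)
  qed
  have d_le: "d i t \<le> \<delta> + integral {0..t} (h i)" if i: "i \<in> {1..P}" and t: "t \<in> {0..T}" for i t
  proof -
    have I: "((\<lambda>s. b i s - b' i s) has_integral (x i t - x0 i - (x' i t - x0' i))) {0..t}"
      using bI[OF i t] by (intro has_integral_diff)
    have "h i integrable_on {0..t}"
      using t by (intro integrable_continuous_real continuous_on_subset[OF hcont[OF i]]) auto
    then have "\<bar>x i t - x0 i - (x' i t - x0' i)\<bar> \<le> integral {0..t} (h i)"
      using Henstock_Kurzweil_Integration.integral_norm_bound_integral[OF has_integral_integrable[OF I], of "h i"]
        b_diff by (simp add: integral_unique[OF I])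
    with x0[OF i] show ?thesis unfolding d_def by linarith
  qed
  have "S T \<le> \<delta> * exp ((A + 2 * A * B) * T)"
  proof (rule gronwall_integral[OF \<open>T \<ge> 0\<close> _ Scont])
    show "S t \<le> \<delta> + (A + 2 * A * B) * integral {0..t} S" if t: "t \<in> {0..T}" for t
    proof -
      have "S t \<le> (1 / real P) * (\<Sum>i=1..P. \<delta> + integral {0..t} (h i))"
        unfolding S_def by (intro mult_left_mono sum_mono d_le t) auto
      also have "\<dots> = \<delta> + (1 / real P) * (\<Sum>i=1..P. integral {0..t} (h i))"
        using P by (simp add: sum.distrib field_simps)
      also have "(\<Sum>i=1..P. integral {0..t} (h i)) = integral {0..t} (\<lambda>s. \<Sum>i=1..P. h i s)"
        using t by (intro integral_sum[symmetric] integrable_continuous_real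
            continuous_on_subset[OF hcont]) auto
      also have "(\<lambda>s. \<Sum>i=1..P. h i s) = (\<lambda>s. (A + 2 * A * B) * real P * S s)"
        using sum_h by simp
      also have "(1 / real P) * integral {0..t} (\<lambda>s. (A + 2 * A * B) * real P * S s)
          = (A + 2 * A * B) * integral {0..t} S"
        using P by simp
      finally show ?thesis .
    qed
  qed (use \<open>A \<ge> 0\<close> \<open>B \<ge> 0\<close> in auto)
  then show ?thesis by (simp add: S_def d_def)
qed

section \<open>Finite subgroups of the circle\<close>

lemma comm_group_real_group: "comm_group real_group"
  by (rule comm_groupI) (auto simp: real_group_def intro: exI[of _ "- _"])

lemma normal_Ints_real_group: "\<int> \<lhd> real_group"
proof -
  interpret comm_group real_group by (rule comm_group_real_group)
  have "inv\<^bsub>real_group\<^esub> x = - x" for x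
    by (rule inv_equality) (simp_all add: real_group_def)
  then have "subgroup \<int> real_group"
    by (intro subgroupI) (auto simp: real_group_def)
  then show ?thesis by (rule subgroup_imp_normal)
qed

lemma mem_coset_Ints_iff: "y \<in> \<int> #>\<^bsub>real_group\<^esub> x \<longleftrightarrow> y - x \<in> \<int>"
proof
  assume "y - x \<in> \<int>"
  then have "\<exists>h\<in>\<int>. y = h + x" by (intro bexI[of _ "y - x"]) auto
  then show "y \<in> \<int> #>\<^bsub>real_group\<^esub> x" by (auto simp: r_coset_def real_group_def)
qed (auto simp: r_coset_def real_group_def)

lemma coset_Ints_eq_iff: "\<int> #>\<^bsub>real_group\<^esub> x = \<int> #>\<^bsub>real_group\<^esub> y \<longleftrightarrow> x - y \<in> \<int>"
proof
  assume "\<int> #>\<^bsub>real_group\<^esub> x = \<int> #>\<^bsub>real_group\<^esub> y"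
  then show "x - y \<in> \<int>" using mem_coset_Ints_iff[of x x] mem_coset_Ints_iff[of x y] by simp
next
  assume *: "x - y \<in> \<int>"
  have "z - x \<in> \<int> \<longleftrightarrow> z - y \<in> \<int>" for z
    using Ints_add[OF _ *, of "z - x"] Ints_diff[OF _ *, of "z - y"] by auto
  then show "\<int> #>\<^bsub>real_group\<^esub> x = \<int> #>\<^bsub>real_group\<^esub> y"
    by (auto simp: mem_coset_Ints_iff)
qed

lemma one_circle_group: "\<one>\<^bsub>circle_group\<^esub> = \<int> #>\<^bsub>real_group\<^esub> 0"
  by (auto simp: circle_group_def FactGroup_def mem_coset_Ints_iff)

text \<open>Translates a statement about powers in the quotient, such as the one Lagrange's theorem
  yields, into one about real multiples modulo 1.\<close>

lemma circle_group_pow: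
  "(\<int> #>\<^bsub>real_group\<^esub> x) [^]\<^bsub>circle_group\<^esub> (n::nat) = \<int> #>\<^bsub>real_group\<^esub> (real n * x)"
proof (induction n)
  case 0
  show ?case by (simp add: one_circle_group)
next
  case (Suc n)
  have "(\<int> #>\<^bsub>real_group\<^esub> y) \<otimes>\<^bsub>circle_group\<^esub> (\<int> #>\<^bsub>real_group\<^esub> z) = \<int> #>\<^bsub>real_group\<^esub> (y + z)" for y z
    using normal.rcos_sum[OF normal_Ints_real_group, of y z]
    by (simp add: circle_group_def FactGroup_def) (simp add: real_group_def)
  with Suc show ?case by (simp add: algebra_simps)
qed

text \<open>By Lagrange the \<open>P\<close>-th power of every element is trivial, so
  \<open>real P * \<zeta> i\<close> is an integer and \<open>\<zeta> i\<close> is congruent to a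
  multiple of \<open>1 / P\<close>. There are only \<open>P\<close> such classes modulo 1, so
  \<open>P\<close> distinct points exhaust them.\<close>

lemma circle_subgroup_equispaced:
  assumes "P \<ge> 1" and \<zeta>: "forms_circle_subgroup P \<zeta>"
  obtains n :: "nat \<Rightarrow> int" where "bij_betw n {1..P} {0..<int P}"
    and "\<And>i. i \<in> {1..P} \<Longrightarrow> \<zeta> i - of_int (n i) / real P \<in> \<int>"
proof -
  define c where "c i = \<int> #>\<^bsub>real_group\<^esub> \<zeta> i" for i
  define H where "H = c ` {1..P}"
  have sub: "subgroup H circle_group" and card: "card H = P"
    using \<zeta> by (simp_all add: forms_circle_subgroup_def Let_def H_def c_def)
  have "group circle_group"
    unfolding circle_group_def by (rule normal.factorgroup_is_group[OF normal_Ints_real_group])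
  then interpret H: group "circle_group\<lparr>carrier := H\<rparr>"
    using subgroup.subgroup_is_group[OF sub] by simp
  have Pz: "real P * \<zeta> i \<in> \<int>" if "i \<in> {1..P}" for i
  proof -
    \<comment> \<open>Lagrange is applied in the group with carrier \<open>H\<close>. Unfolding
      \<open>nat_pow_def\<close> identifies its powers with those of \<open>circle_group\<close>,
      since restricting the carrier leaves multiplication and unit unchanged.\<close>
    have "c i [^]\<^bsub>circle_group\<^esub> P = \<one>\<^bsub>circle_group\<^esub>"
      using H.pow_order_eq_1[of "c i"] that card
      by (simp add: order_def H_def nat_pow_def)
    then show ?thesis
      by (simp add: c_def circle_group_pow one_circle_group coset_Ints_eq_iff)
  qed
  \<comment> \<open>The floor is exact because its argument is an integer. Moving
    \<open>\<zeta> i\<close> by 1 moves that integer by \<open>P\<close>, so reduction modulo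
    \<open>P\<close> yields one label per class.\<close>
  define n where "n i = \<lfloor>real P * \<zeta> i\<rfloor> mod int P" for i
  have n: "\<zeta> i - of_int (n i) / real P \<in> \<int>" if "i \<in> {1..P}" for i
  proof -
    have "real P * \<zeta> i = of_int (\<lfloor>real P * \<zeta> i\<rfloor> div int P * int P + n i)"
      using Pz[OF that] by (simp only: n_def div_mult_mod_eq) (simp add: of_int_floor)
    then have "\<zeta> i - of_int (n i) / real P = of_int (\<lfloor>real P * \<zeta> i\<rfloor> div int P)"
      using \<open>P \<ge> 1\<close> by (simp add: field_simps)
    then show ?thesis by simp
  qed
  have "inj_on n {1..P}"
  proof (rule inj_onI)
    fix i j assume ij: "i \<in> {1..P}" "j \<in> {1..P}" "n i = n j"
    have "\<zeta> i - \<zeta> j \<in> \<int>"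
      using Ints_diff[OF n[OF ij(1)] n[OF ij(2)]] ij(3) by simp
    then have "c i = c j" by (simp add: c_def coset_Ints_eq_iff)
    moreover have "inj_on c {1..P}"
      using card by (intro eq_card_imp_inj_on) (auto simp: H_def)
    ultimately show "i = j" using ij by (auto dest: inj_onD)
  qed
  moreover have "n ` {1..P} = {0..<int P}"
  proof (rule card_subset_eq)
    show "n ` {1..P} \<subseteq> {0..<int P}" using \<open>P \<ge> 1\<close> by (auto simp: n_def)
    show "card (n ` {1..P}) = card {0..<int P}"
      using card_image[OF \<open>inj_on n {1..P}\<close>] by simp
  qed simp
  ultimately have "bij_betw n {1..P} {0..<int P}" by (simp add: bij_betw_def)
  with n that show thesis by blast
qed

lemma bij_betw_add_mod:
  fixes m p :: int
  assumes "p > 0"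
  shows "bij_betw (\<lambda>k. (k + m) mod p) {0..<p} {0..<p}"
proof -
  have inj: "inj_on (\<lambda>k. (k + m) mod p) {0..<p}"
  proof (rule inj_onI)
    fix k l assume kl: "k \<in> {0..<p}" "l \<in> {0..<p}" and "(k + m) mod p = (l + m) mod p"
    then have "(k + m - m) mod p = (l + m - m) mod p" by (metis mod_diff_left_eq)
    with kl show "k = l" by simp
  qed
  moreover have "(\<lambda>k. (k + m) mod p) ` {0..<p} = {0..<p}"
    by (rule endo_inj_surj[OF _ _ inj]) (use assms in auto)
  ultimately show ?thesis by (simp add: bij_betw_def)
qed

text \<open>Write \<open>u - v\<close> as a multiple \<open>m / P\<close> plus a remainder
  \<open>r\<close>. Translation by \<open>m / P\<close> merely permutes the subgroup, so only
  \<open>r\<close> remains as a displacement, common to all points.\<close>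

lemma circle_subgroup_match_translates:
  assumes "P \<ge> 1" and "forms_circle_subgroup P \<zeta>"
  obtains \<sigma> r where "bij_betw \<sigma> {1..P} {1..P}" and "\<bar>r\<bar> \<le> 1 / real P"
    and "\<And>i. i \<in> {1..P} \<Longrightarrow> (\<zeta> i + u) - (\<zeta> (\<sigma> i) + v + r) \<in> \<int>"
proof -
  obtain n :: "nat \<Rightarrow> int" where n: "bij_betw n {1..P} {0..<int P}"
    and \<zeta>n: "\<And>i. i \<in> {1..P} \<Longrightarrow> \<zeta> i - of_int (n i) / real P \<in> \<int>"
    using circle_subgroup_equispaced[OF assms] by blast
  have P: "real P > 0" using \<open>P \<ge> 1\<close> by simp
  define m where "m = \<lfloor>real P * (u - v)\<rfloor>"
  define r where "r = u - v - of_int m / real P"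
  \<comment> \<open>The shift of residues by \<open>m\<close>, transported to the indices by the
    labelling \<open>n\<close>.\<close>
  define \<sigma> where "\<sigma> = inv_into {1..P} n \<circ> ((\<lambda>k. (k + m) mod int P) \<circ> n)"
  have \<sigma>: "bij_betw \<sigma> {1..P} {1..P}"
    unfolding \<sigma>_def using \<open>P \<ge> 1\<close>
    by (intro bij_betw_trans[OF bij_betw_trans[OF n bij_betw_add_mod] bij_betw_inv_into[OF n]]) simp
  moreover have "\<bar>r\<bar> \<le> 1 / real P"
  proof -
    have "real P * r = frac (real P * (u - v))"
      using P by (simp add: r_def m_def frac_def field_simps)
    then have "0 \<le> real P * r" "real P * r \<le> 1"
      using frac_ge_0 frac_lt_1 less_imp_le by metis+
    then show ?thesis using P by (simp add: field_simps zero_le_mult_iff)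
  qed
  moreover have "(\<zeta> i + u) - (\<zeta> (\<sigma> i) + v + r) \<in> \<int>" if i: "i \<in> {1..P}" for i
  proof -
    have \<sigma>i: "\<sigma> i \<in> {1..P}" using \<sigma> i by (auto simp: bij_betw_def)
    have n\<sigma>: "n (\<sigma> i) = (n i + m) mod int P"
      unfolding \<sigma>_def o_def using n \<open>P \<ge> 1\<close> by (intro f_inv_into_f) (auto simp: bij_betw_def)
    \<comment> \<open>\<open>q\<close> counts how often the shifted label passes \<open>P\<close>.
      Each passage is a full turn of the circle and vanishes modulo 1.\<close>
    define q where "q = (n i + m) div int P"
    have "n i + m = q * int P + n (\<sigma> i)"
      by (simp add: n\<sigma> q_def)
    then have "real_of_int (n i) + of_int m = of_int q * real P + of_int (n (\<sigma> i))"
      by (metis of_int_add of_int_mult of_int_of_nat_eq)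
    then have "(of_int (n i) + of_int m - of_int (n (\<sigma> i))) / real P = real_of_int q"
      using P by simp
    then have *: "(\<zeta> i + u) - (\<zeta> (\<sigma> i) + v + r)
        = (\<zeta> i - of_int (n i) / real P) - (\<zeta> (\<sigma> i) - of_int (n (\<sigma> i)) / real P) + of_int q"
      unfolding r_def by (simp add: add_divide_distrib diff_divide_distrib)
    show ?thesis unfolding * by (intro Ints_add Ints_diff \<zeta>n i \<sigma>i) simp
  qed
  ultimately show thesis using that by blast
qed

section \<open>Variance and discrepancy\<close>

text \<open>The empirical frequency and \<open>y\<close> both lie in the unit interval. The bound
  supplies the boundedness from above without which the real-valued suprema carry no
  information.\<close>

lemma star_discrepancy_term_le:
  assumes "P \<ge> 1" and "y \<in> {0..1}"
  shows "\<bar>(1 / real P) * (\<Sum>i=1..P. indicator {0..y} (\<eta> i)) - y\<bar> \<le> 1"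
proof -
  define q :: real where "q = (1 / real P) * (\<Sum>i=1..P. indicator {0..y} (\<eta> i))"
  have "(\<Sum>i=1..P. indicator {0..y} (\<eta> i)) \<le> (\<Sum>i=1..P. 1::real)"
    by (intro sum_mono) (auto simp: indicator_def)
  then have "q \<le> 1" using \<open>P \<ge> 1\<close> by (simp add: q_def field_simps)
  moreover have "q \<ge> 0" unfolding q_def by (intro mult_nonneg_nonneg sum_nonneg) auto
  ultimately have "\<bar>q - y\<bar> \<le> 1" using assms(2) by (auto simp: abs_le_iff)
  then show ?thesis by (simp add: q_def)
qed

text \<open>For the lower bound, the empirical frequency is some multiple \<open>k / P\<close>, and
  no such multiple is closer than half a step to \<open>1 / (2 * real P)\<close>, the midpoint
  between 0 and \<open>1 / P\<close>.\<close>

lemma star_discrepancy_bounds: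
  assumes "P \<ge> 1"
  shows "1 / (2 * real P) \<le> star_discrepancy P \<eta>" and "star_discrepancy P \<eta> \<le> 1"
proof -
  let ?g = "\<lambda>y. \<bar>(1 / real P) * (\<Sum>i=1..P. indicator {0..y} (\<eta> i)) - y\<bar>"
  define y where "y = 1 / (2 * real P)"
  define k where "k = card {i\<in>{1..P}. \<eta> i \<in> {0..y}}"
  have y: "y \<in> {0..1}" using assms by (auto simp: y_def field_simps)
  have "(\<Sum>i=1..P. indicator {0..y} (\<eta> i)) = real k"
    unfolding k_def by (simp add: indicator_def of_bool_def flip: sum.inter_filter)
  then have "?g y = \<bar>(2 * real k - 1) / (2 * real P)\<bar>"
    using assms by (simp only: y_def) (simp add: diff_divide_distrib)
  also have "\<dots> = \<bar>2 * real k - 1\<bar> / (2 * real P)"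
    by simp
  also have "\<dots> \<ge> 1 / (2 * real P)"
    \<comment> \<open>The integer \<open>2 * k - 1\<close> is odd and so at least 1 in absolute
      value: \<open>k = 0\<close> gives -1, and a successor gives at least 1.\<close>
    by (intro divide_right_mono) (cases k, auto)
  finally have "1 / (2 * real P) \<le> ?g y" .
  also have "\<dots> \<le> star_discrepancy P \<eta>"
    unfolding star_discrepancy_def
    by (rule cSUP_upper[OF y]) (use star_discrepancy_term_le[OF assms] in \<open>auto intro!: bdd_aboveI2[of _ _ 1]\<close>)
  finally show "1 / (2 * real P) \<le> star_discrepancy P \<eta>" .
  show "star_discrepancy P \<eta> \<le> 1"
    unfolding star_discrepancy_def
    by (rule cSUP_least) (use star_discrepancy_term_le[OF assms] in auto)
qed

text \<open>The lower bound holds for every shift, so \<open>x = 0\<close> can serve as test point.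
  The upper bound 1 on the discrepancy bounds the set of squares from above.\<close>

lemma SUP_star_discrepancy_squared_ge:
  fixes \<eta> :: "real \<Rightarrow> nat \<Rightarrow> real"
  assumes "P \<ge> 1"
  shows "1 / (4 * (real P)\<^sup>2) \<le> (SUP x\<in>{0..1}. (star_discrepancy P (\<eta> x))\<^sup>2)"
proof -
  have pos: "0 \<le> star_discrepancy P (\<eta> x)" for x
    using star_discrepancy_bounds(1)[OF assms, of "\<eta> x"]
    by (rule order.trans[rotated]) simp
  have "1 / (4 * (real P)\<^sup>2) = (1 / (2 * real P))\<^sup>2"
    by (simp add: power2_eq_square)
  also have "\<dots> \<le> (star_discrepancy P (\<eta> 0))\<^sup>2"
    by (intro power_mono star_discrepancy_bounds assms) simp
  also have "\<dots> \<le> (SUP x\<in>{0..1}. (star_discrepancy P (\<eta> x))\<^sup>2)"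
  proof (rule cSUP_upper)
    show "bdd_above ((\<lambda>x. (star_discrepancy P (\<eta> x))\<^sup>2) ` {0..1})"
      using star_discrepancy_bounds(2)[OF assms] pos by (intro bdd_aboveI2[of _ _ 1]) (simp add: power_le_one)
  qed auto
  finally show ?thesis .
qed

text \<open>The trajectories are given pointwise in \<open>\<omega>\<close> with no measurability
  assumed, so that of the observable has to be derived. Each \<open>\<omega>\<close> with
  \<open>Y \<omega> < c\<close> owns a ball around \<open>U \<omega>\<close> on which the Lipschitz
  bound keeps \<open>Y\<close> below \<open>c\<close>. The union of these balls, though possibly
  uncountable, is open and hence Borel, and its preimage under \<open>U\<close> is the sublevel
  set.\<close>

lemma measurable_of_lipschitz_dependence:
  fixes Y U :: "'a \<Rightarrow> real"
  assumes U: "U \<in> borel_measurable M" and "L > 0"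
    and lip: "\<And>\<omega> \<omega>'. \<omega> \<in> space M \<Longrightarrow> \<omega>' \<in> space M \<Longrightarrow> \<bar>Y \<omega> - Y \<omega>'\<bar> \<le> L * \<bar>U \<omega> - U \<omega>'\<bar>"
  shows "Y \<in> borel_measurable M"
  unfolding borel_measurable_iff_less
proof
  fix c
  define B where "B = (\<Union>\<omega>\<in>{\<omega>\<in>space M. Y \<omega> < c}. ball (U \<omega>) ((c - Y \<omega>) / L))"
  have "{\<omega>\<in>space M. Y \<omega> < c} = U -` B \<inter> space M"
  proof (intro equalityI subsetI)
    fix \<omega> assume "\<omega> \<in> {\<omega>\<in>space M. Y \<omega> < c}"
    then show "\<omega> \<in> U -` B \<inter> space M"
      using \<open>L > 0\<close> by (auto simp: B_def intro!: exI[of _ \<omega>])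
  next
    fix \<omega>' assume "\<omega>' \<in> U -` B \<inter> space M"
    then obtain \<omega> where \<omega>: "\<omega> \<in> space M" "\<omega>' \<in> space M" "\<bar>U \<omega> - U \<omega>'\<bar> < (c - Y \<omega>) / L"
      by (auto simp: B_def dist_real_def)
    then have "L * \<bar>U \<omega> - U \<omega>'\<bar> < c - Y \<omega>"
      using \<open>L > 0\<close> by (simp add: field_simps)
    then show "\<omega>' \<in> {\<omega>\<in>space M. Y \<omega> < c}"
      using lip[OF \<omega>(1,2)] \<omega>(2) by (simp add: abs_le_iff)
  qed
  moreover have "B \<in> sets borel" unfolding B_def by (intro borel_open open_UN) auto
  ultimately show "{\<omega>\<in>space M. Y \<omega> < c} \<in> sets M"
    using measurable_sets[OF U] by simp
qed

text \<open>Fixing one of the two points and averaging the oscillation bound over the other shows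
  that \<open>Y\<close> stays within \<open>c\<close> of its mean everywhere.\<close>

lemma (in prob_space) variance_le_of_oscillation:
  fixes Y :: "'a \<Rightarrow> real"
  assumes Y: "Y \<in> borel_measurable M"
    and osc: "\<And>\<omega> \<omega>'. \<omega> \<in> space M \<Longrightarrow> \<omega>' \<in> space M \<Longrightarrow> \<bar>Y \<omega> - Y \<omega>'\<bar> \<le> c"
  shows "variance Y \<le> c\<^sup>2"
proof -
  obtain \<omega>0 where \<omega>0: "\<omega>0 \<in> space M" using not_empty by blast
  have int: "integrable M Y"
    by (rule integrable_const_bound[of _ "\<bar>Y \<omega>0\<bar> + c"])
      (use osc[OF _ \<omega>0] Y in \<open>auto intro!: AE_I2 simp: abs_le_iff\<close>, fastforce+)
  have dev: "\<bar>Y \<omega> - expectation Y\<bar> \<le> c" if "\<omega> \<in> space M" for \<omega>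
  proof -
    have "expectation Y \<le> Y \<omega> + c"
      by (rule integral_le_const[OF int]) (use osc[OF _ that] in \<open>auto intro!: AE_I2 simp: abs_le_iff algebra_simps\<close>)
    moreover have "Y \<omega> - c \<le> expectation Y"
      by (rule integral_ge_const[OF int]) (use osc[OF that] in \<open>auto intro!: AE_I2 simp: abs_le_iff algebra_simps\<close>)
    ultimately show ?thesis by (simp add: abs_le_iff)
  qed
  have sq: "(Y \<omega> - expectation Y)\<^sup>2 \<le> c\<^sup>2" if "\<omega> \<in> space M" for \<omega>
    using power_mono[OF dev[OF that], of 2] by simp
  have "integrable M (\<lambda>\<omega>. (Y \<omega> - expectation Y)\<^sup>2)"
    by (rule integrable_const_bound[of _ "c\<^sup>2"]) (use sq Y in auto)
  then show ?thesis
    by (rule integral_le_const) (use sq in auto)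
qed

theorem theorem6:
  fixes a \<kappa> :: "real \<times> real \<Rightarrow> real"
    and g f :: "real \<Rightarrow> real"
    and T :: real
    and M :: "'a measure"
    and U :: "'a \<Rightarrow> real"
    and \<zeta> :: "nat \<Rightarrow> nat \<Rightarrow> real"
    and X :: "nat \<Rightarrow> nat \<Rightarrow> real \<Rightarrow> 'a \<Rightarrow> real"
  assumes "T > 0"
    and "bounded_C 2 a"
    and "bounded_C 1 \<kappa>"
    and "C2_bounded_derivatives g"
    and "f C1_differentiable_on UNIV"
    and "\<And>x. f (x + 1) = f x"
    and "prob_space M"
    and "U \<in> borel_measurable M"
    and "distr M lborel U = uniform_measure lborel {0..1}"
    and "\<And>P i. P \<ge> 1 \<Longrightarrow> i \<in> {1..P} \<Longrightarrow> \<zeta> P i \<in> {0..1}"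
    and "\<And>P. P \<ge> 1 \<Longrightarrow> forms_circle_subgroup P (\<zeta> P)"
    and "\<And>P \<omega>. P \<ge> 1 \<Longrightarrow> \<omega> \<in> space M \<Longrightarrow>
           particle_solution a \<kappa> T P (\<lambda>i. f (frac (\<zeta> P i + U \<omega>))) (\<lambda>i t. X P i t \<omega>)"
  shows "\<exists>K. \<forall>P\<ge>1.
           prob_space.variance M (\<lambda>\<omega>. (1 / real P) * (\<Sum>i=1..P. g (X P i T \<omega>)))
             \<le> K * (SUP x\<in>{0..1}. (star_discrepancy P (\<lambda>i. frac (\<zeta> P i + x)))\<^sup>2)"
proof -
  interpret prob_space M by fact
  obtain A where A: "A \<ge> 0"
    "\<And>x y x' y'. \<bar>a (x, y) - a (x', y')\<bar> \<le> A * (\<bar>x - x'\<bar> + \<bar>y - y'\<bar>)"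
    using bounded_C_Suc_lipschitz[of 1 a] assms(2) by (metis Suc_1)
  obtain B where B: "B \<ge> 0"
    "\<And>x y x' y'. \<bar>\<kappa> (x, y) - \<kappa> (x', y')\<bar> \<le> B * (\<bar>x - x'\<bar> + \<bar>y - y'\<bar>)"
    using bounded_C_Suc_lipschitz[of 0 \<kappa>] assms(3) by (metis One_nat_def)
  obtain G where G: "G \<ge> 0" "\<And>x y. \<bar>g x - g y\<bar> \<le> G * \<bar>x - y\<bar>"
    using C2_bounded_derivatives_lipschitz[OF assms(4)] by blast
  obtain F where F: "F \<ge> 0" "\<And>x y. \<bar>f x - f y\<bar> \<le> F * \<bar>x - y\<bar>"
    using periodic_C1_lipschitz[OF assms(5,6)] by blast
  define E where "E = exp ((A + 2 * A * B) * T)"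
  \<comment> \<open>The summand 1 keeps \<open>L\<close> positive even if \<open>G\<close> or
    \<open>F\<close> is 0, as the radii in the measurability argument divide by
    \<open>L\<close>.\<close>
  define L where "L = G * F * E + 1"
  have "E > 0" by (simp add: E_def)
  then have "L > 0" using G(1) F(1) by (simp add: L_def add_nonneg_pos)
  \<comment> \<open>Removing \<open>frac\<close>, which jumps at the integers, makes the initial
    values Lipschitz in \<open>U \<omega>\<close> on the whole line.\<close>
  have f_frac: "f (frac x) = f x" for x
    using periodic_Ints[of f, OF assms(6) frac_diff_Ints] .

  show ?thesis
  \<comment> \<open>The factor 4 compensates the lower bound
    \<open>1 / (4 * (real P)\<^sup>2)\<close> on the supremum.\<close>
  proof (intro exI[of _ "4 * L\<^sup>2"] allI impI)
    fix P :: nat assume P: "P \<ge> 1"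
    define x0 where "x0 \<omega> i = f (frac (\<zeta> P i + U \<omega>))" for \<omega> i
    define Y where "Y \<omega> = (1 / real P) * (\<Sum>i=1..P. g (X P i T \<omega>))" for \<omega>
    \<comment> \<open>Used twice: with the identity and
      \<open>\<rho> = \<bar>U \<omega> - U \<omega>'\<bar>\<close> to obtain measurability, and with
      the matching permutation and \<open>\<rho> = 1 / real P\<close> to bound the oscillation,
      however far apart the two shifts are.\<close>
    have stab: "\<bar>Y \<omega> - Y \<omega>'\<bar> \<le> L * \<rho>"
      if \<omega>: "\<omega> \<in> space M" "\<omega>' \<in> space M" and \<sigma>: "bij_betw \<sigma> {1..P} {1..P}" and "\<rho> \<ge> 0"
        and x0: "\<And>i. i \<in> {1..P} \<Longrightarrow> \<bar>x0 \<omega> i - x0 \<omega>' (\<sigma> i)\<bar> \<le> F * \<rho>" for \<omega> \<omega>' \<sigma> \<rho>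
    proof -
      let ?X = "\<lambda>i t. X P i t \<omega>" and ?X' = "\<lambda>i t. X P i t \<omega>'"
      have sol: "particle_solution a \<kappa> T P (x0 \<omega>) ?X" "particle_solution a \<kappa> T P (x0 \<omega>') ?X'"
        using assms(12)[OF P] \<omega> unfolding x0_def by blast+
      have d: "(1 / real P) * (\<Sum>i=1..P. \<bar>?X i T - ?X' (\<sigma> i) T\<bar>) \<le> F * \<rho> * E"
        using particle_solution_stability[OF less_imp_le[OF assms(1)] A(1) B(1) P A(2) B(2) sol(1)
            particle_solution_reindex[OF sol(2) \<sigma>], of "F * \<rho>"] x0
        by (simp add: E_def)
      have "Y \<omega>' = (1 / real P) * (\<Sum>i=1..P. g (?X' (\<sigma> i) T))"
        unfolding Y_def using sum.reindex_bij_betw[OF \<sigma>, of "\<lambda>i. g (?X' i T)"] by simp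
      then have "Y \<omega> - Y \<omega>' = (1 / real P) * (\<Sum>i=1..P. (g (?X i T) - g (?X' (\<sigma> i) T)))"
        unfolding Y_def[of \<omega>] by (simp add: sum_subtractf diff_divide_distrib)
      then have "\<bar>Y \<omega> - Y \<omega>'\<bar> = (1 / real P) * \<bar>\<Sum>i=1..P. (g (?X i T) - g (?X' (\<sigma> i) T))\<bar>"
        by (simp only: abs_mult) simp
      also have "\<dots> \<le> (1 / real P) * (\<Sum>i=1..P. G * \<bar>?X i T - ?X' (\<sigma> i) T\<bar>)"
        by (intro mult_left_mono order.trans[OF sum_abs] sum_mono G) simp
      also have "\<dots> = G * ((1 / real P) * (\<Sum>i=1..P. \<bar>?X i T - ?X' (\<sigma> i) T\<bar>))"
        by (simp flip: sum_distrib_left)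
      also have "\<dots> \<le> G * (F * \<rho> * E)"
        by (intro mult_left_mono d G)
      also have "\<dots> \<le> L * \<rho>"
        using \<open>\<rho> \<ge> 0\<close> by (simp add: L_def algebra_simps)
      finally show ?thesis .
    qed
    have "\<bar>Y \<omega> - Y \<omega>'\<bar> \<le> L * \<bar>U \<omega> - U \<omega>'\<bar>" if "\<omega> \<in> space M" "\<omega>' \<in> space M" for \<omega> \<omega>'
    proof (rule stab[OF that bij_betw_id[unfolded id_def]])
      show "\<bar>x0 \<omega> i - x0 \<omega>' i\<bar> \<le> F * \<bar>U \<omega> - U \<omega>'\<bar>" for i
        using F(2)[of "\<zeta> P i + U \<omega>" "\<zeta> P i + U \<omega>'"] by (simp add: x0_def f_frac)
    qed simp
    then have "Y \<in> borel_measurable M"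
      using measurable_of_lipschitz_dependence[OF assms(8) \<open>L > 0\<close>] by blast
    moreover have "\<bar>Y \<omega> - Y \<omega>'\<bar> \<le> L * (1 / real P)" if \<omega>: "\<omega> \<in> space M" "\<omega>' \<in> space M" for \<omega> \<omega>'
    proof -
      obtain \<sigma> r where \<sigma>: "bij_betw \<sigma> {1..P} {1..P}" and r: "\<bar>r\<bar> \<le> 1 / real P"
        and match: "\<And>i. i \<in> {1..P} \<Longrightarrow> (\<zeta> P i + U \<omega>) - (\<zeta> P (\<sigma> i) + U \<omega>' + r) \<in> \<int>"
        using circle_subgroup_match_translates[OF P assms(11)[OF P], of "U \<omega>" "U \<omega>'"] by blast
      show ?thesis
      proof (rule stab[OF \<omega> \<sigma>])
        fix i assume "i \<in> {1..P}"
        then have "x0 \<omega> i = f (\<zeta> P (\<sigma> i) + U \<omega>' + r)"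
          using periodic_Ints[of f, OF assms(6) match] by (simp add: x0_def f_frac)
        then have "\<bar>x0 \<omega> i - x0 \<omega>' (\<sigma> i)\<bar> \<le> F * \<bar>r\<bar>"
          using F(2)[of "\<zeta> P (\<sigma> i) + U \<omega>' + r" "\<zeta> P (\<sigma> i) + U \<omega>'"] by (simp add: x0_def f_frac)
        also have "\<dots> \<le> F * (1 / real P)" using r F(1) by (rule mult_left_mono)
        finally show "\<bar>x0 \<omega> i - x0 \<omega>' (\<sigma> i)\<bar> \<le> F * (1 / real P)" .
      qed simp
    qed
    ultimately have "variance Y \<le> (L * (1 / real P))\<^sup>2"
      by (rule variance_le_of_oscillation)
    also have "\<dots> = 4 * L\<^sup>2 * (1 / (4 * (real P)\<^sup>2))"
      by (simp add: power_divide)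
    also have "\<dots> \<le> 4 * L\<^sup>2 * (SUP x\<in>{0..1}. (star_discrepancy P (\<lambda>i. frac (\<zeta> P i + x)))\<^sup>2)"
      by (intro mult_left_mono SUP_star_discrepancy_squared_ge[OF P]) simp
    finally show "variance (\<lambda>\<omega>. (1 / real P) * (\<Sum>i=1..P. g (X P i T \<omega>)))
        \<le> 4 * L\<^sup>2 * (SUP x\<in>{0..1}. (star_discrepancy P (\<lambda>i. frac (\<zeta> P i + x)))\<^sup>2)"
      unfolding Y_def .
  qed
qed

end
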